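(* Let $q\ge 27$ be a prime power with $q\equiv 3\pmod 4$, let $\xi$ be a primitive element of $F_q$, $P=(0,1,0)$, $Z=(1,0,-1)$. For an integer $\overline{J}$ let $\mathcal{Q}_{\overline{J}}=\{P,Z\}\cup\{(1,\xi^d,\xi^{2d}): d=0,1,\dots,\overline{J}\}$, and let $\overline{J}_q$ be the smallest integer $\overline{J}$ such that all points $(1,a,b)$ with $a\in F_q\setminus\{0\}$, $b\in F_q$, $b\ne a^2$, and all points $(0,1,b)$ with $b\in F_q\setminus\{0\}$ lie on bisecants of $\mathcal{Q}_{\overline{J}}$. Assume $\overline{J}_q\le (q-3)/2$ and let $J$ be an integer with $\max\{\overline{J}_q,(q-3)/4\}\le J\le (q-3)/2$. Then $\mathcal{E}_J=\{(1,\xi^d,\xi^{2d}): d=0,\dots,J\}\cup\{P,Z,(1,0,-\xi^{2J})\}$ is a complete arc in $PG(2,q)$.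
   Context: Points of $PG(2,q)$ are in homogeneous coordinates $(x_0,x_1,x_2)$. A bisecant of a point set is a line through two of its distinct points. An arc is a set of points no three collinear; it is complete if it is not contained in a larger arc. *)

theory Defs
  imports Complex_Main "HOL-Library.Cardinality"
begin

text \<open>
  The plane \<open>PG(2,q)\<close> over a finite field \<open>'a\<close> with \<open>q = CARD('a)\<close>. A point is the class of all
  nonzero scalar multiples of a nonzero triple; a line is the set of the points satisfying a
  nontrivial homogeneous linear equation.
\<close>

type_synonym 'a pg_point = "('a \<times> 'a \<times> 'a) set"

definition hpt :: "'a::field \<Rightarrow> 'a \<Rightarrow> 'a \<Rightarrow> 'a pg_point" where
  "hpt x0 x1 x2 = {(k * x0, k * x1, k * x2) | k. k \<noteq> 0}"

definition pg_points :: "'a::field pg_point set" where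
  "pg_points = {hpt x0 x1 x2 | x0 x1 x2. (x0, x1, x2) \<noteq> (0, 0, 0)}"

definition pg_line :: "'a::field \<Rightarrow> 'a \<Rightarrow> 'a \<Rightarrow> 'a pg_point set" where
  "pg_line u0 u1 u2 =
     {hpt x0 x1 x2 | x0 x1 x2. (x0, x1, x2) \<noteq> (0, 0, 0) \<and> u0 * x0 + u1 * x1 + u2 * x2 = 0}"

definition pg_lines :: "'a::field pg_point set set" where
  "pg_lines = {pg_line u0 u1 u2 | u0 u1 u2. (u0, u1, u2) \<noteq> (0, 0, 0)}"

definition bisecant :: "'a::field pg_point set \<Rightarrow> 'a pg_point set \<Rightarrow> bool" where
  "bisecant S l \<longleftrightarrow> l \<in> pg_lines \<and> (\<exists>A\<in>S. \<exists>B\<in>S. A \<noteq> B \<and> A \<in> l \<and> B \<in> l)"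

definition on_bisecant :: "'a::field pg_point set \<Rightarrow> 'a pg_point \<Rightarrow> bool" where
  "on_bisecant S A \<longleftrightarrow> (\<exists>l. bisecant S l \<and> A \<in> l)"

definition pg_collinear :: "'a::field pg_point set \<Rightarrow> bool" where
  "pg_collinear S \<longleftrightarrow> (\<exists>l\<in>pg_lines. S \<subseteq> l)"

definition arc :: "'a::field pg_point set \<Rightarrow> bool" where
  "arc K \<longleftrightarrow> K \<subseteq> pg_points \<and>
     (\<forall>A\<in>K. \<forall>B\<in>K. \<forall>C\<in>K. A \<noteq> B \<and> A \<noteq> C \<and> B \<noteq> C \<longrightarrow> \<not> pg_collinear {A, B, C})"

definition complete_arc :: "'a::field pg_point set \<Rightarrow> bool" where
  "complete_arc K \<longleftrightarrow> arc K \<and> \<not> (\<exists>K'. arc K' \<and> K \<subset> K')"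

definition primitive_element :: "'a::field \<Rightarrow> bool" where
  "primitive_element \<xi> \<longleftrightarrow> range (\<lambda>n::nat. \<xi> ^ n) = UNIV - {0}"

definition conic_part :: "'a::field \<Rightarrow> int \<Rightarrow> 'a pg_point set" where
  "conic_part \<xi> J = {hpt 1 (\<xi> ^ d) (\<xi> ^ (2 * d)) | d::nat. int d \<le> J}"

definition Q_set :: "'a::field \<Rightarrow> int \<Rightarrow> 'a pg_point set" where
  "Q_set \<xi> J = {hpt 0 1 0, hpt 1 0 (- 1)} \<union> conic_part \<xi> J"

definition Q_covers :: "'a::field \<Rightarrow> int \<Rightarrow> bool" where
  "Q_covers \<xi> J \<longleftrightarrow>
     (\<forall>a b. a \<noteq> 0 \<and> b \<noteq> a\<^sup>2 \<longrightarrow> on_bisecant (Q_set \<xi> J) (hpt 1 a b)) \<and>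
     (\<forall>b. b \<noteq> 0 \<longrightarrow> on_bisecant (Q_set \<xi> J) (hpt 0 1 b))"

text \<open>
  The minimum exists for \<open>q \<ge> 27\<close>: \<open>Q_covers\<close> fails for negative \<open>J\<close>, where only the
  line joining the two extra points is a bisecant, and holds for \<open>J = q - 2\<close>.
\<close>

definition Jbar :: "'a::field \<Rightarrow> int" where
  "Jbar \<xi> = (LEAST J. Q_covers \<xi> J)"

definition E_set :: "'a::field \<Rightarrow> int \<Rightarrow> 'a pg_point set" where
  "E_set \<xi> J =
     conic_part \<xi> J \<union> {hpt 0 1 0, hpt 1 0 (- 1), hpt 1 0 (- (\<xi> ^ (2 * nat J)))}"

end

theory Submission
  imports Defs
begin

text \<open>
  Write \<open>q = 4 m + 3\<close>, so that \<open>\<xi>\<close> has order \<open>4 m + 2\<close>, \<open>\<xi> ^ (2 m + 1) = - 1\<close>, and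
  \<open>m \<le> J \<le> 2 m\<close>. Let \<open>A d = (1, \<xi> ^ d, \<xi> ^ (2 d))\<close> and \<open>W = (1, 0, - \<xi> ^ (2 J))\<close>.
  For \<open>d \<noteq> e\<close> modulo \<open>4 m + 2\<close>, the points \<open>A d\<close>, \<open>A e\<close> are collinear with \<open>P\<close> iff
  \<open>d - e \<equiv> 2 m + 1\<close>, with \<open>Z\<close> iff \<open>d + e \<equiv> 0\<close>, and with \<open>W\<close> iff \<open>d + e \<equiv> 2 J\<close>.
  None of these happens for \<open>0 \<le> d, e \<le> J\<close>; since \<open>- 1\<close> is not a square, no \<open>A d\<close> is collinear
  with \<open>P\<close> and one of \<open>Z\<close>, \<open>W\<close> either, which gives the arc property.
  For completeness, the points \<open>A d\<close> with \<open>J < d < 4 m + 2\<close> lie on a bisecant through \<open>W\<close> if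
  \<open>d \<le> 2 J\<close>, through \<open>P\<close> if \<open>2 m + 1 \<le> d \<le> 2 m + 1 + J\<close>, and through \<open>Z\<close> if
  \<open>d \<ge> 4 m + 2 - J\<close>; these ranges are exhaustive because \<open>J \<ge> m\<close>. The line \<open>ZW\<close> covers
  \<open>x1 = 0\<close>, and the remaining points are covered by the choice of \<open>Jbar\<close>. That
  \<open>Jbar\<close> is a genuine minimum is seen by counting: a point off the conic fails to lie on the chord
  from \<open>(1, t, t\<^sup>2)\<close> to another conic point with nonzero parameter for at most five values of \<open>t\<close>.
\<close>

section \<open>Collinearity by determinants\<close>

text \<open>The coefficients of \<open>c0\<close>, \<open>c1\<close>, \<open>c2\<close> form the
  cross product of the first two triples, that is, the coordinates of the line joining these
  points.\<close>

definition det3 :: "'a::field \<Rightarrow> 'a \<Rightarrow> 'a \<Rightarrow> 'a \<Rightarrow> 'a \<Rightarrow> 'a \<Rightarrow> 'a \<Rightarrow> 'a \<Rightarrow> 'a \<Rightarrow> 'a" where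
  "det3 a0 a1 a2 b0 b1 b2 c0 c1 c2 =
     (a1 * b2 - a2 * b1) * c0 + (a2 * b0 - a0 * b2) * c1 + (a0 * b1 - a1 * b0) * c2"

lemma hpt_eq_iff:
  "hpt a0 a1 a2 = hpt b0 b1 b2 \<longleftrightarrow>
     (\<exists>k. k \<noteq> 0 \<and> a0 = k * b0 \<and> a1 = k * b1 \<and> a2 = k * (b2 :: 'a::field))"
proof
  assume *: "hpt a0 a1 a2 = hpt b0 b1 b2"
  have "(1 * a0, 1 * a1, 1 * a2) \<in> hpt a0 a1 a2"
    unfolding hpt_def using one_neq_zero by blast
  with * have "(a0, a1, a2) \<in> hpt b0 b1 b2" by simp
  then show "\<exists>k. k \<noteq> 0 \<and> a0 = k * b0 \<and> a1 = k * b1 \<and> a2 = k * b2"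
    unfolding hpt_def by auto
next
  assume "\<exists>k. k \<noteq> 0 \<and> a0 = k * b0 \<and> a1 = k * b1 \<and> a2 = k * b2"
  then obtain k where k: "k \<noteq> 0" "a0 = k * b0" "a1 = k * b1" "a2 = k * b2" by blast
  have "\<exists>j'. (j * a0, j * a1, j * a2) = (j' * b0, j' * b1, j' * b2) \<and> j' \<noteq> 0" if "j \<noteq> 0" for j
    using that k by (intro exI[of _ "j * k"]) (simp add: mult.assoc)
  moreover have "\<exists>j'. (j * b0, j * b1, j * b2) = (j' * a0, j' * a1, j' * a2) \<and> j' \<noteq> 0"
    if "j \<noteq> 0" for j
    using that k by (intro exI[of _ "j / k"]) simp
  ultimately show "hpt a0 a1 a2 = hpt b0 b1 b2"
    unfolding hpt_def by blast
qed

lemma hpt_affine_eq_iff [simp]: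
  "hpt 1 a b = hpt 1 c d \<longleftrightarrow> a = c \<and> b = (d :: 'a::field)"
  "hpt 0 a b \<noteq> hpt 1 c d"
  "hpt 1 c d \<noteq> hpt 0 a b"
  by (auto simp: hpt_eq_iff)

lemma hpt_in_pg_line_iff:
  assumes "(x0, x1, x2) \<noteq> (0, 0, 0 :: 'a::field)"
  shows "hpt x0 x1 x2 \<in> pg_line u0 u1 u2 \<longleftrightarrow> u0 * x0 + u1 * x1 + u2 * x2 = 0"
proof
  assume "hpt x0 x1 x2 \<in> pg_line u0 u1 u2"
  then obtain y0 y1 y2 where "hpt x0 x1 x2 = hpt y0 y1 y2"
    and y: "u0 * y0 + u1 * y1 + u2 * y2 = 0"
    unfolding pg_line_def by blast
  then obtain k where "x0 = k * y0" "x1 = k * y1" "x2 = k * y2"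
    unfolding hpt_eq_iff by blast
  then have "u0 * x0 + u1 * x1 + u2 * x2 = k * (u0 * y0 + u1 * y1 + u2 * y2)"
    by (simp add: algebra_simps)
  then show "u0 * x0 + u1 * x1 + u2 * x2 = 0" using y by simp
next
  assume "u0 * x0 + u1 * x1 + u2 * x2 = 0"
  then show "hpt x0 x1 x2 \<in> pg_line u0 u1 u2"
    unfolding pg_line_def using assms by blast
qed

lemma hpt_eq_if_cross_product_zero:
  fixes a0 a1 a2 b0 b1 b2 :: "'a::field"
  assumes "(a0, a1, a2) \<noteq> (0, 0, 0)" "(b0, b1, b2) \<noteq> (0, 0, 0)"
    and "a1 * b2 = a2 * b1" "a2 * b0 = a0 * b2" "a0 * b1 = a1 * b0"
  shows "hpt a0 a1 a2 = hpt b0 b1 b2"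
proof -
  consider "b0 \<noteq> 0" | "b0 = 0" "b1 \<noteq> 0" | "b0 = 0" "b1 = 0" "b2 \<noteq> 0"
    using assms(2) by auto
  then show ?thesis
  proof cases
    case 1
    then show ?thesis unfolding hpt_eq_iff
      using assms by (intro exI[of _ "a0 / b0"]) (auto simp: field_simps)
  next
    case 2
    then show ?thesis unfolding hpt_eq_iff
      using assms by (intro exI[of _ "a1 / b1"]) (auto simp: field_simps)
  next
    case 3
    then show ?thesis unfolding hpt_eq_iff
      using assms by (intro exI[of _ "a2 / b2"]) (auto simp: field_simps)
  qed
qed

text \<open>Cramer's rule: if a line passes through all three points, the determinant times each of
  its coordinates vanishes.\<close>

lemma not_pg_collinear_if_det3:
  fixes a0 a1 a2 b0 b1 b2 c0 c1 c2 :: "'a::field"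
  assumes "det3 a0 a1 a2 b0 b1 b2 c0 c1 c2 \<noteq> 0"
  shows "\<not> pg_collinear {hpt a0 a1 a2, hpt b0 b1 b2, hpt c0 c1 c2}"
proof
  assume "pg_collinear {hpt a0 a1 a2, hpt b0 b1 b2, hpt c0 c1 c2}"
  then obtain u0 u1 u2 where u: "(u0, u1, u2) \<noteq> (0, 0, 0)"
    and l: "hpt a0 a1 a2 \<in> pg_line u0 u1 u2" "hpt b0 b1 b2 \<in> pg_line u0 u1 u2"
      "hpt c0 c1 c2 \<in> pg_line u0 u1 u2"
    unfolding pg_collinear_def pg_lines_def by auto
  have "(a0, a1, a2) \<noteq> (0, 0, 0)" "(b0, b1, b2) \<noteq> (0, 0, 0)" "(c0, c1, c2) \<noteq> (0, 0, 0)"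
    using assms unfolding det3_def by auto
  with l have
    "u0 * a0 + u1 * a1 + u2 * a2 = 0" "u0 * b0 + u1 * b1 + u2 * b2 = 0"
    "u0 * c0 + u1 * c1 + u2 * c2 = 0"
    by (simp_all add: hpt_in_pg_line_iff)
  then have "u0 * det3 a0 a1 a2 b0 b1 b2 c0 c1 c2 = 0"
    "u1 * det3 a0 a1 a2 b0 b1 b2 c0 c1 c2 = 0"
    "u2 * det3 a0 a1 a2 b0 b1 b2 c0 c1 c2 = 0"
    unfolding det3_def by algebra+
  with assms u show False by auto
qed

lemma on_bisecant_if_det3:
  fixes a0 a1 a2 b0 b1 b2 c0 c1 c2 :: "'a::field"
  assumes "hpt a0 a1 a2 \<in> S" "hpt b0 b1 b2 \<in> S" "hpt a0 a1 a2 \<noteq> hpt b0 b1 b2"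
    and nz: "(a0, a1, a2) \<noteq> (0, 0, 0)" "(b0, b1, b2) \<noteq> (0, 0, 0)" "(c0, c1, c2) \<noteq> (0, 0, 0)"
    and det: "det3 a0 a1 a2 b0 b1 b2 c0 c1 c2 = 0"
  shows "on_bisecant S (hpt c0 c1 c2)"
proof -
  define u0 u1 u2 where "u0 = a1 * b2 - a2 * b1" and "u1 = a2 * b0 - a0 * b2"
    and "u2 = a0 * b1 - a1 * b0"
  have "(u0, u1, u2) \<noteq> (0, 0, 0)"
    using hpt_eq_if_cross_product_zero[OF nz(1,2)] assms(3)
    unfolding u0_def u1_def u2_def by auto
  then have "pg_line u0 u1 u2 \<in> pg_lines" unfolding pg_lines_def by blast
  moreover have "hpt a0 a1 a2 \<in> pg_line u0 u1 u2" "hpt b0 b1 b2 \<in> pg_line u0 u1 u2"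
    by (simp_all only: hpt_in_pg_line_iff nz not_False_eq_True)
      (simp_all add: u0_def u1_def u2_def algebra_simps)
  moreover have "hpt c0 c1 c2 \<in> pg_line u0 u1 u2"
    using det nz(3) by (simp add: hpt_in_pg_line_iff det3_def u0_def u1_def u2_def)
  ultimately show ?thesis
    unfolding on_bisecant_def bisecant_def using assms(1-3) by blast
qed

section \<open>Arcs\<close>

text \<open>The first two normal forms are the shapes occurring in \<open>Q_covers\<close>; the last
  point lies on the line \<open>x1 = 0\<close>, which joins Z and W.\<close>

lemma pg_points_cases:
  assumes "X \<in> (pg_points :: 'a::field pg_point set)"
  obtains a b where "X = hpt 1 a b" | b where "X = hpt 0 1 b" | "X = hpt 0 0 1"
proof -
  obtain x0 x1 x2 where X: "X = hpt x0 x1 x2" "(x0, x1, x2) \<noteq> (0, 0, 0)"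
    using assms unfolding pg_points_def by blast
  consider "x0 \<noteq> 0" | "x0 = 0" "x1 \<noteq> 0" | "x0 = 0" "x1 = 0" "x2 \<noteq> 0"
    using X(2) by auto
  then show ?thesis
  proof cases
    case 1
    then have "X = hpt 1 (x1 / x0) (x2 / x0)"
      unfolding X(1) hpt_eq_iff by (intro exI[of _ x0]) simp
    then show ?thesis by (rule that(1))
  next
    case 2
    then have "X = hpt 0 1 (x2 / x1)"
      unfolding X(1) hpt_eq_iff by (intro exI[of _ x1]) simp
    then show ?thesis by (rule that(2))
  next
    case 3
    then have "X = hpt 0 0 1"
      unfolding X(1) hpt_eq_iff by (intro exI[of _ x2]) simp
    then show ?thesis by (rule that(3))
  qed
qed

lemma on_bisecant_mono: "on_bisecant S X \<Longrightarrow> S \<subseteq> T \<Longrightarrow> on_bisecant T X"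
  unfolding on_bisecant_def bisecant_def by blast

text \<open>Lets an arc grow by one point at a time, so that only triples containing the new point
  have to be checked.\<close>

lemma arc_insert:
  assumes "arc K" "X \<in> pg_points" "pairwise (\<lambda>A B. \<not> pg_collinear {X, A, B}) K"
  shows "arc (insert X K)"
proof -
  have X: "\<not> pg_collinear {X, A, B}" if "A \<in> K" "B \<in> K" "A \<noteq> B" for A B
    using assms(3) that unfolding pairwise_def by blast
  have "\<not> pg_collinear {A, B, C}"
    if "A \<in> insert X K" "B \<in> insert X K" "C \<in> insert X K" "A \<noteq> B" "A \<noteq> C" "B \<noteq> C" for A B C
  proof -
    consider "A = X" "B \<in> K" "C \<in> K" | "B = X" "A \<in> K" "C \<in> K" | "C = X" "A \<in> K" "B \<in> K"
      | "A \<in> K" "B \<in> K" "C \<in> K"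
      using \<open>A \<in> insert X K\<close> \<open>B \<in> insert X K\<close> \<open>C \<in> insert X K\<close> \<open>A \<noteq> B\<close> \<open>A \<noteq> C\<close> \<open>B \<noteq> C\<close> by auto
    then show ?thesis
    proof cases
      case 1
      with X[of B C] that show ?thesis by simp
    next
      case 2
      with X[of A C] that show ?thesis by (simp add: insert_commute)
    next
      case 3
      with X[of A B] that show ?thesis by (simp add: insert_commute)
    next
      case 4
      with assms(1) that show ?thesis unfolding arc_def by blast
    qed
  qed
  with assms(1,2) show ?thesis unfolding arc_def by blast
qed

lemma complete_arcI:
  assumes "arc K" "\<And>X. X \<in> pg_points \<Longrightarrow> X \<notin> K \<Longrightarrow> on_bisecant K X"
  shows "complete_arc K"
proof -
  have False if K': "arc K'" "K \<subset> K'" for K'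
  proof -
    obtain X where X: "X \<in> K'" "X \<notin> K" using K'(2) by blast
    then have "X \<in> pg_points" using K'(1) unfolding arc_def by blast
    with assms(2) X have "on_bisecant K X" by blast
    then obtain l A B where "l \<in> pg_lines" "A \<in> K" "B \<in> K" "A \<noteq> B" "{A, B, X} \<subseteq> l"
      unfolding on_bisecant_def bisecant_def by auto
    moreover from this have "A \<noteq> X" "B \<noteq> X" "A \<in> K'" "B \<in> K'" using X K'(2) by auto
    ultimately show False
      using K'(1) X(1) unfolding arc_def pg_collinear_def by metis
  qed
  with assms(1) show ?thesis unfolding complete_arc_def by blast
qed

section \<open>Powers of a primitive element\<close>

lemma primitive_element_nonzero: "primitive_element \<xi> \<Longrightarrow> \<xi> \<noteq> (0 :: 'a::field)"
  unfolding primitive_element_def using power_one_right[of \<xi>]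
  by (metis Diff_iff rangeI singletonI)

lemma primitive_element_log:
  assumes "primitive_element \<xi>" "a \<noteq> (0 :: 'a::field)"
  obtains n :: nat where "a = \<xi> ^ n"
proof -
  have "a \<in> range (\<lambda>n::nat. \<xi> ^ n)"
    using assms unfolding primitive_element_def by simp
  then show ?thesis using that by blast
qed

lemma power_mod_period:
  assumes "(\<xi> :: 'a::monoid_mult) ^ n = 1"
  shows "\<xi> ^ (k mod n) = \<xi> ^ k"
proof -
  have "\<xi> ^ k = \<xi> ^ (n * (k div n) + k mod n)" by simp
  also have "\<dots> = (\<xi> ^ n) ^ (k div n) * \<xi> ^ (k mod n)" by (simp only: power_add power_mult)
  finally show ?thesis using assms by simp
qed

lemma power_diff_eq_one:
  assumes "\<xi> ^ i = \<xi> ^ j" "i \<le> j" "(\<xi> :: 'a::field) \<noteq> 0"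
  shows "\<xi> ^ (j - i) = 1"
  using assms by (simp add: power_diff)

text \<open>If \<open>\<xi> ^ n = 1\<close>, then \<open>\<xi>\<close> has at most \<open>n\<close>
  distinct powers, yet these exhaust the nonzero elements.\<close>

lemma primitive_element_period_ge:
  fixes \<xi> :: "'a::{field,finite}"
  assumes "primitive_element \<xi>" "n > 0" "\<xi> ^ n = 1"
  shows "CARD('a) - 1 \<le> n"
proof -
  have "UNIV - {0} \<subseteq> (\<lambda>k. \<xi> ^ k) ` {..<n}"
  proof
    fix a :: 'a assume "a \<in> UNIV - {0}"
    then obtain k where "a = \<xi> ^ k" using primitive_element_log[OF assms(1)] by auto
    then have "a = \<xi> ^ (k mod n)" using power_mod_period[OF assms(3)] by simp
    then show "a \<in> (\<lambda>k. \<xi> ^ k) ` {..<n}" using assms(2) by simp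
  qed
  then have "card (UNIV - {0 :: 'a}) \<le> card ((\<lambda>k. \<xi> ^ k) ` {..<n})"
    by (rule card_mono[rotated]) simp
  also have "\<dots> \<le> card {..<n}" by (rule card_image_le) simp
  finally show ?thesis by (simp add: card_Diff_singleton)
qed

text \<open>Pigeonhole: among \<open>CARD('a)\<close> exponents two give the same power. Their
  difference is a period of at most \<open>CARD('a) - 1\<close>, and no positive period is shorter
  than that.\<close>

lemma primitive_element_power_card:
  fixes \<xi> :: "'a::{field,finite}"
  assumes "primitive_element \<xi>"
  shows "\<xi> ^ (CARD('a) - 1) = 1"
proof -
  have "\<not> inj_on (\<lambda>k. \<xi> ^ k) {..<CARD('a)}"
  proof
    assume "inj_on (\<lambda>k. \<xi> ^ k) {..<CARD('a)}"
    moreover have "(\<lambda>k. \<xi> ^ k) ` {..<CARD('a)} \<subseteq> UNIV - {0}"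
      using primitive_element_nonzero[OF assms] by auto
    ultimately have "card {..<CARD('a)} \<le> card (UNIV - {0 :: 'a})"
      by (rule card_inj_on_le) simp
    moreover have "CARD('a) > 0" by simp
    ultimately show False by (simp add: card_Diff_singleton del: zero_less_card_finite)
  qed
  then obtain i j where "i < CARD('a)" "j < CARD('a)" "\<xi> ^ i = \<xi> ^ j" "i \<noteq> j"
    unfolding inj_on_def by auto
  then obtain i j where ij: "j < CARD('a)" "\<xi> ^ i = \<xi> ^ j" "i < j"
    by (metis nat_neq_iff)
  then have "\<xi> ^ (j - i) = 1"
    by (intro power_diff_eq_one primitive_element_nonzero assms) simp_all
  moreover from this have "CARD('a) - 1 \<le> j - i"
    using primitive_element_period_ge[OF assms] ij by simp
  then have "j - i = CARD('a) - 1" using ij by simp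
  ultimately show ?thesis by simp
qed

lemma primitive_element_power_eq_iff:
  fixes \<xi> :: "'a::{field,finite}"
  assumes "primitive_element \<xi>"
  shows "\<xi> ^ i = \<xi> ^ j \<longleftrightarrow> i mod (CARD('a) - 1) = j mod (CARD('a) - 1)"
proof
  let ?n = "CARD('a) - 1"
  have per: "\<xi> ^ (k mod ?n) = \<xi> ^ k" for k
    by (rule power_mod_period[OF primitive_element_power_card[OF assms]])
  show "\<xi> ^ i = \<xi> ^ j" if "i mod ?n = j mod ?n"
    using per[of i] per[of j] that by simp
  have "card {0, 1 :: 'a} \<le> CARD('a)" by (rule card_mono) simp_all
  then have n: "?n > 0" by simp
  have not_less: "\<not> r < s" if "\<xi> ^ r = \<xi> ^ s" "s < ?n" for r s
  proof
    assume "r < s"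
    with that have "\<xi> ^ (s - r) = 1"
      by (intro power_diff_eq_one primitive_element_nonzero assms) simp_all
    with primitive_element_period_ge[OF assms, of "s - r"] \<open>r < s\<close> that show False by simp
  qed
  show "i mod ?n = j mod ?n" if "\<xi> ^ i = \<xi> ^ j"
    using not_less[of "i mod ?n" "j mod ?n"] not_less[of "j mod ?n" "i mod ?n"] that per n
    by (metis mod_less_divisor nat_neq_iff)
qed

section \<open>Existence of the minimum defining Jbar\<close>

text \<open>The integers are not well-ordered, so \<open>LEAST\<close> needs a lower bound
  \<open>b\<close>: the solutions up to \<open>k\<close> then form a finite nonempty set, whose
  minimum is the global one.\<close>

lemma Least_int_exists:
  fixes P :: "int \<Rightarrow> bool"
  assumes "P k" "\<And>j. P j \<Longrightarrow> b \<le> j"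
  shows "P (LEAST j. P j)"
proof -
  define S where "S = {j. P j \<and> j \<le> k}"
  have "S \<subseteq> {b..k}" unfolding S_def using assms(2) by auto
  then have fin: "finite S" by (rule finite_subset) simp
  have "k \<in> S" unfolding S_def using assms(1) by simp
  have "(LEAST j. P j) = Min S"
  proof (rule Least_equality)
    show "P (Min S)" using Min_in[OF fin] \<open>k \<in> S\<close> unfolding S_def by blast
    show "Min S \<le> j" if "P j" for j
    proof (cases "j \<le> k")
      case True
      with that have "j \<in> S" unfolding S_def by simp
      then show ?thesis by (rule Min_le[OF fin])
    next
      case False
      with Min_le[OF fin \<open>k \<in> S\<close>] show ?thesis by simp
    qed
  qed
  then show ?thesis using Min_in[OF fin] \<open>k \<in> S\<close> unfolding S_def by auto
qed

lemma exists_notin_of_card_less: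
  assumes "finite S" "card S < CARD('a::finite)"
  shows "\<exists>x::'a. x \<notin> S"
  using assms by (metis UNIV_eq_I less_irrefl)

text \<open>By Vieta, a root \<open>r\<close> leaves only \<open>2 * a - r\<close> as another root;
  this argument is valid in every characteristic.\<close>

lemma quadratic_roots_subset:
  "\<exists>r s. {t. t\<^sup>2 - 2 * a * t + b = 0} \<subseteq> {r, s :: 'a::field}"
proof (cases "\<exists>r. r\<^sup>2 - 2 * a * r + b = 0")
  case True
  then obtain r where r: "r\<^sup>2 - 2 * a * r + b = 0" by blast
  have "t = r \<or> t = 2 * a - r" if "t\<^sup>2 - 2 * a * t + b = 0" for t
  proof -
    have "(t - r) * (t - (2 * a - r)) = 0" using r that by algebra
    then show ?thesis by (metis eq_iff_diff_eq_0 mult_eq_0_iff)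
  qed
  then show ?thesis by blast
qed blast

lemma not_Q_covers_negative:
  assumes "J < 0"
  shows "\<not> Q_covers (\<xi> :: 'a::field) J"
proof
  assume "Q_covers \<xi> J"
  \<comment> \<open>The point (1,1,0) must be covered, but it is off the line PZ, which has equation
    \<open>x0 + x2 = 0\<close> and is the only bisecant here.\<close>
  then have "on_bisecant (Q_set \<xi> J) (hpt 1 1 0)" unfolding Q_covers_def by auto
  moreover have "Q_set \<xi> J = {hpt 0 1 0, hpt 1 0 (- 1)}"
    using assms unfolding Q_set_def conic_part_def by auto
  ultimately have "pg_collinear {hpt 0 1 0, hpt 1 0 (- 1), hpt 1 1 (0 :: 'a)}"
    unfolding on_bisecant_def bisecant_def pg_collinear_def by auto
  moreover have "\<not> pg_collinear {hpt 0 1 0, hpt 1 0 (- 1), hpt 1 1 (0 :: 'a)}"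
    by (rule not_pg_collinear_if_det3) (simp add: det3_def)
  ultimately show False by simp
qed

text \<open>The last assumption is the equation of the chord with parameters \<open>t\<close> and
  \<open>s\<close>; the determinant is this equation multiplied by \<open>s - t\<close>.\<close>

lemma conic_chord_on_bisecant:
  assumes "hpt 1 t (t\<^sup>2) \<in> S" "hpt 1 s (s\<^sup>2) \<in> S" "s \<noteq> t"
    and "(c0, c1, c2) \<noteq> (0, 0, 0)" "c2 + t * s * c0 = (t + s) * (c1 :: 'a::field)"
  shows "on_bisecant S (hpt c0 c1 c2)"
proof (rule on_bisecant_if_det3[OF assms(1,2)])
  have "det3 1 t (t\<^sup>2) 1 s (s\<^sup>2) c0 c1 c2 = (s - t) * (c2 + t * s * c0 - (t + s) * c1)"
    unfolding det3_def by algebra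
  then show "det3 1 t (t\<^sup>2) 1 s (s\<^sup>2) c0 c1 c2 = 0" using assms(5) by simp
qed (use assms in simp_all)

lemma conic_part_eq:
  "conic_part \<xi> (int j) = (\<lambda>t. hpt 1 t (t\<^sup>2)) ` (\<lambda>d. \<xi> ^ d) ` {..j}"
  unfolding conic_part_def by (auto simp: image_iff power_even_eq)

lemma Q_covers_card:
  fixes \<xi> :: "'a::{field,finite}"
  assumes "primitive_element \<xi>" "CARD('a) \<ge> 6"
  shows "Q_covers \<xi> (int (CARD('a)))"
proof -
  let ?Q = "Q_set \<xi> (int (CARD('a)))"
  have conic: "hpt 1 t (t\<^sup>2) \<in> ?Q" if "t \<noteq> 0" for t
  proof -
    from that obtain k where k: "t = \<xi> ^ k" using primitive_element_log[OF assms(1)] by blast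
    let ?d = "k mod (CARD('a) - 1)"
    have "t = \<xi> ^ ?d"
      using power_mod_period[OF primitive_element_power_card[OF assms(1)]] k by simp
    moreover have "?d < CARD('a) - 1" using assms(2) by simp
    then have "?d \<in> {..CARD('a)}" by simp
    ultimately have "t \<in> (\<lambda>d. \<xi> ^ d) ` {..CARD('a)}" by (rule image_eqI)
    then show ?thesis unfolding Q_set_def conic_part_eq by blast
  qed
  have "on_bisecant ?Q (hpt 1 a b)" if "a \<noteq> 0" "b \<noteq> a\<^sup>2" for a b
  proof -
    obtain r s where rs: "{t. t\<^sup>2 - 2 * a * t + b = 0} \<subseteq> {r, s}"
      using quadratic_roots_subset by blast
    have "card {0, a, b / a, r, s} \<le> 5"
      using card_length[of "[0, a, b / a, r, s]"] by simp
    \<comment> \<open>Excluding \<open>a\<close> makes the chord equation solvable for the second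
      parameter \<open>u\<close>; excluding \<open>b / a\<close> makes \<open>u\<close> nonzero, and
      excluding the roots \<open>r\<close>, \<open>s\<close> makes
      \<open>u \<noteq> t\<close>.\<close>
    then obtain t where t: "t \<notin> {0, a, b / a, r, s}"
      using exists_notin_of_card_less[of "{0, a, b / a, r, s}"] assms(2) by auto
    define u where "u = (b - t * a) / (a - t)"
    have u: "u * (a - t) = b - t * a" using t unfolding u_def by auto
    have "u \<noteq> 0" using t \<open>a \<noteq> 0\<close> u by (auto simp: field_simps)
    moreover have "u \<noteq> t"
    proof
      assume "u = t"
      with u have "t\<^sup>2 - 2 * a * t + b = 0" by algebra
      with rs t show False by auto
    qed
    moreover have "b + t * u * 1 = (t + u) * a" using u by (simp add: algebra_simps)
    ultimately show ?thesis
      using t by (intro conic_chord_on_bisecant[OF conic conic, of t u]) auto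
  qed
  moreover have "on_bisecant ?Q (hpt 0 1 b)" if "b \<noteq> 0" for b
  proof -
    have "card {0, b, b / 2} \<le> 5" using card_length[of "[0, b, b / 2]"] by simp
    then obtain t where t: "t \<notin> {0, b, b / 2}"
      using exists_notin_of_card_less[of "{0, b, b / 2}"] assms(2) by auto
    \<comment> \<open>The second parameter is \<open>b - t\<close>. In characteristic 2 the quotient
      \<open>b / 2\<close> is the default value 0, but there \<open>b = 2 * t\<close> contradicts
      \<open>b \<noteq> 0\<close>.\<close>
    have "b - t \<noteq> t"
    proof
      assume "b - t = t"
      then have b: "b = 2 * t" by (simp add: algebra_simps)
      with \<open>b \<noteq> 0\<close> have "(2 :: 'a) \<noteq> 0" by auto
      with b t show False by simp
    qed
    then show ?thesis
      using t by (intro conic_chord_on_bisecant[OF conic conic, of t "b - t"]) auto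
  qed
  ultimately show ?thesis unfolding Q_covers_def by blast
qed

lemma Q_covers_Jbar:
  fixes \<xi> :: "'a::{field,finite}"
  assumes "primitive_element \<xi>" "CARD('a) \<ge> 6"
  shows "Q_covers \<xi> (Jbar \<xi>)"
  unfolding Jbar_def
proof (rule Least_int_exists[where b = 0])
  show "Q_covers \<xi> (int (CARD('a)))" by (rule Q_covers_card[OF assms])
  show "0 \<le> j" if "Q_covers \<xi> j" for j
    using not_Q_covers_negative[of j \<xi>] that by linarith
qed

section \<open>The complete arc\<close>

lemma not_pg_collinear_conic_chord:
  fixes c0 c1 c2 t s :: "'a::field"
  assumes "s \<noteq> t" "c2 + t * s * c0 \<noteq> (t + s) * c1"
  shows "\<not> pg_collinear {hpt c0 c1 c2, hpt 1 t (t\<^sup>2), hpt 1 s (s\<^sup>2)}"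
proof (rule not_pg_collinear_if_det3)
  have "det3 c0 c1 c2 1 t (t\<^sup>2) 1 s (s\<^sup>2) = (s - t) * (c2 + t * s * c0 - (t + s) * c1)"
    unfolding det3_def by algebra
  then show "det3 c0 c1 c2 1 t (t\<^sup>2) 1 s (s\<^sup>2) \<noteq> 0" using assms by simp
qed

lemma arc_conic:
  "arc ((\<lambda>t. hpt 1 t (t\<^sup>2)) ` (T :: 'a::field set))"
proof -
  have "\<not> pg_collinear {hpt 1 r (r\<^sup>2), hpt 1 t (t\<^sup>2), hpt 1 s (s\<^sup>2)}"
    if "r \<noteq> t" "r \<noteq> s" "t \<noteq> s" for r s t :: 'a
  proof (rule not_pg_collinear_conic_chord)
    \<comment> \<open>This product is the chord equation evaluated at the conic point with parameter
      \<open>r\<close>.\<close>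
    have "(r - t) * (r - s) \<noteq> 0" using that by simp
    then show "r\<^sup>2 + t * s * 1 \<noteq> (t + s) * r" by algebra
  qed (use that in simp)
  moreover have "hpt 1 t (t\<^sup>2) \<in> pg_points" for t :: 'a
    unfolding pg_points_def by fastforce
  ultimately show ?thesis unfolding arc_def by auto
qed

text \<open>P, Z, W are added in this order. \<open>opp\<close> excludes chords through P,
  \<open>prod\<close> chords through Z and W, and \<open>sq\<close> conic points on PZ and PW. The
  line ZW meets the affine conic only at parameter 0, and \<open>w \<noteq> 1\<close> keeps Z and W
  apart.\<close>

lemma arc_conic_with_three_points:
  fixes T :: "'a::field set" and w :: 'a
  assumes "0 \<notin> T" "w \<noteq> 1"
    and opp: "\<And>t s. t \<in> T \<Longrightarrow> s \<in> T \<Longrightarrow> s \<noteq> - t"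
    and sq: "\<And>t. t \<in> T \<Longrightarrow> t\<^sup>2 \<noteq> - 1" "\<And>t. t \<in> T \<Longrightarrow> t\<^sup>2 \<noteq> - w"
    and prod: "\<And>t s. t \<in> T \<Longrightarrow> s \<in> T \<Longrightarrow> t \<noteq> s \<Longrightarrow> t * s \<noteq> 1"
      "\<And>t s. t \<in> T \<Longrightarrow> s \<in> T \<Longrightarrow> t \<noteq> s \<Longrightarrow> t * s \<noteq> w"
  shows "arc (insert (hpt 1 0 (- w)) (insert (hpt 1 0 (- 1)) (insert (hpt 0 1 0)
           ((\<lambda>t. hpt 1 t (t\<^sup>2)) ` T))))"
proof -
  let ?C = "(\<lambda>t. hpt 1 t (t\<^sup>2)) ` T"
  let ?P = "hpt 0 1 (0 :: 'a)" and ?Z = "hpt 1 0 (- 1 :: 'a)" and ?W = "hpt 1 0 (- w)"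
  have P: "\<not> pg_collinear {?P, hpt 1 t (t\<^sup>2), hpt 1 s (s\<^sup>2)}"
    if "t \<in> T" "s \<in> T" "t \<noteq> s" for t s
  proof (rule not_pg_collinear_conic_chord)
    show "0 + t * s * 0 \<noteq> (t + s) * 1" using opp[OF that(1,2)] by (simp add: add_eq_0_iff)
  qed (use that in simp)
  have Z: "\<not> pg_collinear {hpt 1 0 (- v), hpt 1 t (t\<^sup>2), hpt 1 s (s\<^sup>2)}"
    if "t \<noteq> s" "t * s \<noteq> v" for t s v :: 'a
    using that by (intro not_pg_collinear_conic_chord) auto
  have ZP: "\<not> pg_collinear {hpt 1 0 (- v), ?P, hpt 1 t (t\<^sup>2)}" if "t\<^sup>2 \<noteq> - v" for t v :: 'a
    using that by (intro not_pg_collinear_if_det3) (simp add: det3_def eq_neg_iff_add_eq_0 add.commute)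
  have WZ: "\<not> pg_collinear {?W, ?Z, hpt 1 t (t\<^sup>2)}" if "t \<in> T" for t
    using that assms(1,2) by (intro not_pg_collinear_if_det3) (auto simp: det3_def algebra_simps)
  have WZP: "\<not> pg_collinear {?W, ?Z, ?P}"
    using assms(2) by (intro not_pg_collinear_if_det3) (simp add: det3_def)
  have pts: "?P \<in> pg_points" "?Z \<in> pg_points" "?W \<in> pg_points"
    unfolding pg_points_def by fastforce+
  have pairP: "pairwise (\<lambda>A B. \<not> pg_collinear {?P, A, B}) ?C"
    using P by (auto simp: pairwise_def)
  have "pairwise (\<lambda>A B. \<not> pg_collinear {?Z, A, B}) ?C"
    using Z[of _ _ 1] prod(1) by (auto simp: pairwise_def)
  then have pairZ: "pairwise (\<lambda>A B. \<not> pg_collinear {?Z, A, B}) (insert ?P ?C)"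
    using ZP[of _ 1] sq(1) by (auto simp: pairwise_insert insert_commute)
  have "pairwise (\<lambda>A B. \<not> pg_collinear {?W, A, B}) ?C"
    using Z[of _ _ w] prod(2) by (auto simp: pairwise_def)
  then have pairW: "pairwise (\<lambda>A B. \<not> pg_collinear {?W, A, B}) (insert ?Z (insert ?P ?C))"
    using ZP[of _ w] sq(2) WZ WZP by (auto simp: pairwise_insert insert_commute)
  show ?thesis
    by (intro arc_insert arc_conic pts pairP pairZ pairW)
qed

theorem theorem21:
  fixes \<xi> :: "'a::{field,finite}" and q :: nat and J :: int
  assumes "q = CARD('a)"
    and "q \<ge> 27"
    and "q mod 4 = 3"
    and "primitive_element \<xi>"
    and "real_of_int (Jbar \<xi>) \<le> (real q - 3) / 2"
    and "max (real_of_int (Jbar \<xi>)) ((real q - 3) / 4) \<le> real_of_int J"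
    and "real_of_int J \<le> (real q - 3) / 2"
  shows "complete_arc (E_set \<xi> J)"
proof -
  define m where "m = q div 4"
  have q: "q = 4 * m + 3" using assms(3) unfolding m_def by presburger
  have m: "m \<ge> 6" using assms(2) q by simp
  have "Jbar \<xi> \<le> J" "real m \<le> real_of_int J" "real_of_int J \<le> 2 * real m"
    using assms(6,7) q by simp_all
  then have J: "Jbar \<xi> \<le> J" "int m \<le> J" "J \<le> 2 * int m" by linarith+
  define j where "j = nat J"
  have Jj: "J = int j" and j: "m \<le> j" "j \<le> 2 * m" unfolding j_def using J by linarith+
  have n: "CARD('a) - 1 = 4 * m + 2" using assms(1) q by simp
  note nz = primitive_element_nonzero[OF assms(4)]
  have pow_eq: "\<xi> ^ i = \<xi> ^ k \<longleftrightarrow> i mod (4 * m + 2) = k mod (4 * m + 2)" for i k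
    using primitive_element_power_eq_iff[OF assms(4)] n by simp
  have pow_inj: "i = k" if "\<xi> ^ i = \<xi> ^ k" "i < 4 * m + 2" "k < 4 * m + 2" for i k
    using that pow_eq by simp
  \<comment> \<open>The period is even, so the parity of an exponent is well defined; this is how
    nonsquares are recognised below.\<close>
  have pow_parity: "even i \<longleftrightarrow> even k" if "\<xi> ^ i = \<xi> ^ k" for i k
    using that unfolding pow_eq by (metis dvd_add dvd_mod_iff dvd_refl dvd_triv_left even_mult_iff even_numeral)
  have period: "\<xi> ^ (4 * m + 2) = 1"
    using pow_eq[of "4 * m + 2" 0] by simp
  have minus1: "\<xi> ^ (2 * m + 1) = - 1"
  proof -
    have "(\<xi> ^ (2 * m + 1))\<^sup>2 = \<xi> ^ ((2 * m + 1) * 2)" by (rule power_mult[symmetric])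
    also have "(2 * m + 1) * 2 = 4 * m + 2" by simp
    finally have "(\<xi> ^ (2 * m + 1))\<^sup>2 = 1" using period by simp
    moreover have "\<xi> ^ (2 * m + 1) \<noteq> 1" using pow_inj[of "2 * m + 1" 0] by auto
    ultimately show ?thesis using power2_eq_1_iff by blast
  qed
  then have minus: "- (\<xi> ^ i) = \<xi> ^ (i + 2 * m + 1)" for i
    using power_add[of \<xi> i "2 * m + 1"] by (simp add: add.assoc)

  let ?P = "hpt 0 1 (0 :: 'a)" and ?Z = "hpt 1 0 (- 1 :: 'a)" and ?W = "hpt 1 0 (- (\<xi> ^ (2 * j)))"
  let ?T = "(\<lambda>d. \<xi> ^ d) ` {..j}"
  have E: "E_set \<xi> J = insert ?W (insert ?Z (insert ?P ((\<lambda>t. hpt 1 t (t\<^sup>2)) ` ?T)))"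
    unfolding E_set_def Jj conic_part_eq by auto

  have "\<xi> ^ (2 * j) \<noteq> 1" using pow_inj[of "2 * j" 0] j m by auto
  have "arc (E_set \<xi> J)"
    unfolding E
  proof (rule arc_conic_with_three_points)
    show "0 \<notin> ?T" using nz by auto
    show "\<xi> ^ (2 * j) \<noteq> 1" by fact
  next
    fix t s assume "t \<in> ?T" "s \<in> ?T"
    then obtain d e where de: "t = \<xi> ^ d" "s = \<xi> ^ e" "d \<le> j" "e \<le> j" by auto
    \<comment> \<open>Negation adds \<open>2 * m + 1\<close> to the exponent, and
      \<open>e \<le> 2 * m < d + 2 * m + 1 < 4 * m + 2\<close>, so no reduction modulo the period
      occurs.\<close>
    show "s \<noteq> - t"
      using pow_inj[of e "d + 2 * m + 1"] de j unfolding de(1,2) minus by auto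
    assume "t \<noteq> s"
    with de have "d \<noteq> e" by auto
    \<comment> \<open>As \<open>d\<close> and \<open>e\<close> are distinct and at most
      \<open>j\<close>, their sum lies strictly between 0 and \<open>2 * j\<close>, which is below
      the period.\<close>
    show "t * s \<noteq> 1"
      using pow_inj[of "d + e" 0] de j \<open>d \<noteq> e\<close> unfolding de(1,2) by (auto simp flip: power_add)
    show "t * s \<noteq> \<xi> ^ (2 * j)"
      using pow_inj[of "d + e" "2 * j"] de j \<open>d \<noteq> e\<close> unfolding de(1,2) by (auto simp flip: power_add)
  next
    fix t assume "t \<in> ?T"
    then obtain d where t: "t = \<xi> ^ d" by auto
    have t2: "t\<^sup>2 = \<xi> ^ (2 * d)" unfolding t by (simp only: power_even_eq)
    \<comment> \<open>Squares have even exponents, while both excluded values have odd ones.\<close>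
    show "t\<^sup>2 \<noteq> - 1"
      using pow_parity[of "2 * d" "2 * m + 1"] minus1 unfolding t2 by auto
    show "t\<^sup>2 \<noteq> - (\<xi> ^ (2 * j))"
      using pow_parity[of "2 * d" "2 * j + 2 * m + 1"] unfolding t2 minus by auto
  qed

  moreover have "on_bisecant (E_set \<xi> J) X" if X: "X \<in> pg_points" "X \<notin> E_set \<xi> J" for X
  proof -
    have "Q_set \<xi> (Jbar \<xi>) \<subseteq> E_set \<xi> J"
      using J(1) unfolding Q_set_def E_set_def conic_part_def by auto
    moreover have "Q_covers \<xi> (Jbar \<xi>)"
      using Q_covers_Jbar[OF assms(4)] assms(1,2) by simp
    ultimately have cov: "a \<noteq> 0 \<Longrightarrow> b \<noteq> a\<^sup>2 \<Longrightarrow> on_bisecant (E_set \<xi> J) (hpt 1 a b)"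
      "b \<noteq> 0 \<Longrightarrow> on_bisecant (E_set \<xi> J) (hpt 0 1 b)" for a b
      unfolding Q_covers_def by (blast intro: on_bisecant_mono)+
    have PZW: "?P \<in> E_set \<xi> J" "?Z \<in> E_set \<xi> J" "?W \<in> E_set \<xi> J" unfolding E by auto
    have ZW: "on_bisecant (E_set \<xi> J) (hpt c0 0 c2)" if "(c0, c2) \<noteq> (0, 0)" for c0 c2
      using that \<open>\<xi> ^ (2 * j) \<noteq> 1\<close>
      by (intro on_bisecant_if_det3[OF PZW(2,3)]) (auto simp: det3_def)
    from X(1) show ?thesis
    proof (cases rule: pg_points_cases)
      case (1 a b)
      consider "a = 0" | "a \<noteq> 0" "b \<noteq> a\<^sup>2" | "a \<noteq> 0" "b = a\<^sup>2" by blast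
      then show ?thesis
      proof cases
        case 3
        obtain k where k: "a = \<xi> ^ k" by (rule primitive_element_log[OF assms(4) 3(1)])
        define d where "d = k mod (4 * m + 2)"
        have a: "a = \<xi> ^ d" unfolding d_def using k power_mod_period[OF period] by simp
        have d: "d < 4 * m + 2" unfolding d_def by simp
        have conic: "hpt 1 (\<xi> ^ e) ((\<xi> ^ e)\<^sup>2) \<in> E_set \<xi> J" if "e \<le> j" for e
          using that unfolding E by blast
        have "d > j"
        proof (rule ccontr)
          assume "\<not> d > j"
          then show False using conic[of d] X(2) 1 3 a by simp
        qed
        \<comment> \<open>From \<open>m \<le> j\<close> follow \<open>2 * m \<le> 2 * j\<close> and
          \<open>4 * m + 2 - j \<le> 2 * m + 2 + j\<close>, so no gap is left. In each range the
          chosen \<open>e\<close> is at most \<open>j\<close>, which puts the second conic point in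
          the arc.\<close>
        consider (W) "d \<le> 2 * j" | (P) "2 * m + 1 \<le> d" "d \<le> 2 * m + 1 + j"
          | (Z) "4 * m + 2 - j \<le> d"
          using j by linarith
        then show ?thesis
        proof cases
          case W
          define e where "e = 2 * j - d"
          have "\<xi> ^ (2 * j) = \<xi> ^ e * a" unfolding a e_def using W by (simp flip: power_add)
          moreover have "e \<le> j" unfolding e_def using \<open>d > j\<close> by simp
          ultimately show ?thesis
            using nz unfolding 1 3
            by (intro on_bisecant_if_det3[OF PZW(3) conic[of e]])
              (auto simp: det3_def algebra_simps power2_eq_square)
        next
          case P
          define e where "e = d - (2 * m + 1)"
          have "a = - (\<xi> ^ e)" unfolding a e_def minus using P by simp
          moreover have "e \<le> j" unfolding e_def using P by simp
          ultimately show ?thesis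
            unfolding 1 3
            by (intro on_bisecant_if_det3[OF PZW(1) conic[of e]]) (auto simp: det3_def)
        next
          case Z
          define e where "e = 4 * m + 2 - d"
          have "\<xi> ^ e * a = \<xi> ^ (4 * m + 2)" unfolding a e_def using d by (simp flip: power_add)
          then have "\<xi> ^ e * a = 1" using period by simp
          moreover have "e \<le> j" unfolding e_def using Z by simp
          ultimately show ?thesis
            using nz unfolding 1 3
            by (intro on_bisecant_if_det3[OF PZW(2) conic[of e]])
              (auto simp: det3_def algebra_simps power2_eq_square)
        qed
      qed (use 1 ZW[of 1 b] cov(1) in auto)
    next
      case (2 b)
      with X(2) PZW(1) have "b \<noteq> 0" by auto
      with 2 cov(2) show ?thesis by simp
    next
      case 3
      with ZW[of 0 1] show ?thesis by simp
    qed
  qed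
  ultimately show ?thesis by (rule complete_arcI)
qed

end
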